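(* There exists a non-terminating game of two-player Beggar-My-Neighbor with a standard 52-card deck dealt equally (26 cards to each player). Explicitly, consider the starting deal (top card of each hand at the left; player 1 starts) Player 1: $\texttt{---K---Q-KQAJ-----AAJ--J--}$ Player 2: $\texttt{----------Q----KQ-J-----KA}$ The game from this deal never terminates. After 4 tricks it enters a cycle of 62 tricks, of which the first repeating state is Player 1: $\texttt{---AAJ--J--------K---------Q-Q-K---Q-KAQJ-}$ Player 2: $\texttt{-----KA-J-}$ with player 2 to play next. That is, after 4 tricks the game is in this state, and it returns to this state for the first time after 62 further tricks and hence every 62 tricks thereafter, while none of the states before the fourth trick is completed belongs to the cycle.
   Context: Cards and hands. Suits are irrelevant. A card is one of: an ace $\texttt{A}$, a king $\texttt{K}$, a queen $\texttt{Q}$, a jack $\texttt{J}$ (these four types are the court, or face, cards), or a number card, written $\texttt{-}$. A standard deck has 52 cards: 4 each of $\texttt{A},\texttt{K},\texttt{Q},\texttt{J}$ and 36 number cards. A hand (pack) is a finite sequence of cards, written as a string with the top of the hand (next card to be played) at the left. In the strings, each single hyphen is one number card. State. A state (between tricks) consists of the hand of player 1, the hand of player 2, and which player is to play next (start the next trick). Rules of Beggar-My-Neighbor. The player to start lays the top card of his hand face up on the (initially empty) table pile; the players then alternate, each laying the top card of his hand on the pile, as long as no court card appears. When a player lays a court card, his opponent has to pay: he must lay up to 4 cards in succession for an ace, 3 for a king, 2 for a queen, 1 for a jack, taken from the top of his hand. If all the required cards are number cards, the player who laid the court card wins the trick. If during the payment a court card is laid, the payment stops at once and the roles are reversed: the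 other player now has to pay to this new court card in the same way; the trick continues until some player pays in full with number cards only. The winner of the trick takes the whole pile and places it under (at the bottom of) his hand, in the order the cards were played (the first card played in the trick is nearest the top, so in string notation the pile, written in order of play, is appended at the right end of the winner's string). The winner of the trick starts the next trick. Termination. The game terminates if one player gets all the cards (in particular if a player who must lay a card has none left, in which case his opponent gets all the cards and wins). A game is non-terminating if it continues through infinitely many tricks. Play is deterministic. *)

theory Defs
  imports "HOL-Library.Multiset"
begin

datatype card = Ace | King | Queen | Jack | Number

definition standard_deck :: "card multiset" where
  "standard_deck =
     replicate_mset 4 Ace + replicate_mset 4 King + replicate_mset 4 Queen +
     replicate_mset 4 Jack + replicate_mset 36 Number"

definition equal_deal :: "card list \<Rightarrow> card list \<Rightarrow> bool" where
  "equal_deal h1 h2 \<longleftrightarrow>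
     mset h1 + mset h2 = standard_deck \<and> length h1 = 26 \<and> length h2 = 26"

text \<open>Hands are lists with the top card first. The string notation is only meant for strings
  over the characters A, K, Q, J and - (a single hyphen is one number card).\<close>

definition card_of_char :: "char \<Rightarrow> card" where
  "card_of_char x =
     (if x = CHR ''A'' then Ace
      else if x = CHR ''K'' then King
      else if x = CHR ''Q'' then Queen
      else if x = CHR ''J'' then Jack
      else Number)"

definition hand :: "string \<Rightarrow> card list" where
  "hand s = map card_of_char s"

datatype player = P1 | P2

fun opponent :: "player \<Rightarrow> player" where
  "opponent P1 = P2"
| "opponent P2 = P1"

datatype state = State (hand1: "card list") (hand2: "card list") (to_play: player)

fun state_for :: "player \<Rightarrow> card list \<Rightarrow> card list \<Rightarrow> state" where
  "state_for P1 own opp = State own opp P1"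
| "state_for P2 own opp = State opp own P2"

fun payment :: "card \<Rightarrow> nat option" where
  "payment Ace = Some 4"
| "payment King = Some 3"
| "payment Queen = Some 2"
| "payment Jack = Some 1"
| "payment Number = None"

text \<open>In \<open>lay p own opp pile due\<close>, player \<open>p\<close> with hand \<open>own\<close> has to lay the next card, his
  opponent holds \<open>opp\<close>, and \<open>pile\<close> is listed in order of play. \<open>due\<close> is \<open>None\<close> as long as no
  court card has appeared in the trick, and \<open>Some n\<close> if \<open>p\<close> still has to lay \<open>n\<close> cards to the
  last court card. The result is the state after the trick; if \<open>p\<close> has no card to lay, the
  opponent takes everything, which leaves \<open>p\<close> with an empty hand.\<close>

function lay ::
  "player \<Rightarrow> card list \<Rightarrow> card list \<Rightarrow> card list \<Rightarrow> nat option \<Rightarrow> state" where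
  "lay p [] opp pile due = state_for (opponent p) (opp @ pile) []"
| "lay p (c # own) opp pile due =
     (case payment c of
        Some d \<Rightarrow> lay (opponent p) opp own (pile @ [c]) (Some d)
      | None \<Rightarrow>
          (case due of
             None \<Rightarrow> lay (opponent p) opp own (pile @ [c]) None
           | Some n \<Rightarrow>
               if n \<le> 1 then state_for (opponent p) (opp @ pile @ [c]) own
               else lay p own opp (pile @ [c]) (Some (n - 1))))"
  by pat_completeness auto
termination
  by (relation "measure (\<lambda>(p, own, opp, pile, due). length own + length opp)") auto

fun trick :: "state \<Rightarrow> state" where
  "trick (State h1 h2 P1) = lay P1 h1 h2 [] None"
| "trick (State h1 h2 P2) = lay P2 h2 h1 [] None"

definition after_tricks :: "nat \<Rightarrow> state \<Rightarrow> state" where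
  "after_tricks n s = (trick ^^ n) s"

definition game_over :: "state \<Rightarrow> bool" where
  "game_over s \<longleftrightarrow> hand1 s = [] \<or> hand2 s = []"

definition non_terminating :: "state \<Rightarrow> bool" where
  "non_terminating s \<longleftrightarrow> (\<forall>n. \<not> game_over (after_tricks n s))"

end

theory Submission
  imports Defs
begin

text \<open>Play is a deterministic map \<open>trick\<close> on states, so an orbit that returns to
  one of its states is periodic from there on, and every claim about all times becomes a finite
  check. Evaluation gives the entry into the cycle (\<open>deal_to_cycle\<close>) and the return
  (\<open>cycle_returns\<close>). Nontermination then only needs nonempty hands in the 4 states
  before the cycle and the 62 on it (\<open>non_terminatingI\<close>). The list
  \<open>iterates\<close> holds an orbit segment, built by one \<open>trick\<close> per entry, so
  that such checks can be run by \<open>code_simp\<close>.\<close>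

fun iterates :: "nat \<Rightarrow> state \<Rightarrow> state list" where
  "iterates 0 s = []"
| "iterates (Suc n) s = s # iterates n (trick s)"

lemma length_iterates: "length (iterates n s) = n"
  by (induction n arbitrary: s) auto

lemma nth_iterates: "k < n \<Longrightarrow> iterates n s ! k = after_tricks k s"
  by (induction n arbitrary: s k) (auto simp: after_tricks_def nth_Cons' funpow_swap1 gr0_conv_Suc)

lemma after_tricks_in_iterates: "k < n \<Longrightarrow> after_tricks k s \<in> set (iterates n s)"
  by (metis length_iterates nth_iterates nth_mem)

lemma after_tricks_add: "after_tricks (m + n) s = after_tricks m (after_tricks n s)"
  by (simp add: after_tricks_def funpow_add)

lemma after_tricks_period_mult:
  assumes "after_tricks p s = s"
  shows "after_tricks (p * m) s = s"
  by (induction m) (simp_all add: assms after_tricks_add after_tricks_def[of 0])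

lemma after_tricks_mod_period:
  assumes "after_tricks p s = s"
  shows "after_tricks (n mod p) s = after_tricks n s"
  by (metis after_tricks_add after_tricks_period_mult assms mod_mult_div_eq)

text \<open>A tail of length \<open>q\<close> followed by a loop of length \<open>p\<close> exhausts
  the orbit, so two finite lists cover all times.\<close>

lemma non_terminatingI:
  assumes "after_tricks q s = c" "after_tricks p c = c" "0 < p"
    and "list_all (\<lambda>t. \<not> game_over t) (iterates q s)"
    and "list_all (\<lambda>t. \<not> game_over t) (iterates p c)"
  shows "non_terminating s"
  unfolding non_terminating_def
proof
  fix n
  show "\<not> game_over (after_tricks n s)"
  proof (cases "n < q")
    case True
    then show ?thesis
      using assms(4) after_tricks_in_iterates by (auto simp: list_all_iff)
  next
    case False
    then have "after_tricks n s = after_tricks (n - q) c"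
      using after_tricks_add[of "n - q" q s] assms(1) by simp
    also have "\<dots> = after_tricks ((n - q) mod p) c"
      using after_tricks_mod_period[OF assms(2)] by simp
    finally show ?thesis
      \<comment> \<open>Since \<open>0 < p\<close>, the residue is below \<open>p\<close>, so this
        state is in the list checked for the loop.\<close>
      using assms(3,5) after_tricks_in_iterates[of "(n - q) mod p" p c]
      by (auto simp: list_all_iff)
  qed
qed

definition deal :: state where
  "deal = State (hand ''---K---Q-KQAJ-----AAJ--J--'') (hand ''----------Q----KQ-J-----KA'') P1"

definition cycle_state :: state where
  "cycle_state = State (hand ''---AAJ--J--------K---------Q-Q-K---Q-KAQJ-'') (hand ''-----KA-J-'') P2"

lemma equal_deal_start:
  "equal_deal (hand ''---K---Q-KQAJ-----AAJ--J--'') (hand ''----------Q----KQ-J-----KA'')"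
  by (simp add: equal_deal_def hand_def card_of_char_def standard_deck_def numeral_eq_Suc)

lemma deal_to_cycle: "after_tricks 4 deal = cycle_state"
  by code_simp

lemma cycle_returns: "after_tricks 62 cycle_state = cycle_state"
  by code_simp

lemma deal_not_over: "list_all (\<lambda>t. \<not> game_over t) (iterates 4 deal)"
  by code_simp

lemma cycle_not_over: "list_all (\<lambda>t. \<not> game_over t) (iterates 62 cycle_state)"
  by code_simp

text \<open>Starting one trick late, the 61 entries are the states after 1 to 61 tricks; the trivial
  return at 0 and the true one at 62 are left out.\<close>

lemma cycle_first_return: "list_all (\<lambda>t. t \<noteq> cycle_state) (iterates 61 (trick cycle_state))"
  by code_simp

text \<open>By periodicity these 62 states are the whole cycle, so the state just before entry lies
  off it.\<close>

lemma deal_last_before_cycle: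
  "list_all (\<lambda>t. t \<noteq> after_tricks 3 deal) (iterates 62 cycle_state)"
  by code_simp

lemma cycle_minimal:
  assumes "0 < k" "k < 62"
  shows "after_tricks k cycle_state \<noteq> cycle_state"
proof -
  have "after_tricks k cycle_state = after_tricks (k - 1) (trick cycle_state)"
    using after_tricks_add[of "k - 1" 1 cycle_state] assms(1) by (simp add: after_tricks_def[of "Suc 0"])
  moreover have "after_tricks (k - 1) (trick cycle_state) \<in> set (iterates 61 (trick cycle_state))"
    using assms by (intro after_tricks_in_iterates) simp
  ultimately show ?thesis
    using cycle_first_return by (auto simp: list_all_iff)
qed

text \<open>The cycle is closed under \<open>trick\<close>, so it suffices that the state after three tricks is not on it.\<close>

lemma before_cycle:
  assumes "i < 4"
  shows "after_tricks i deal \<noteq> after_tricks j cycle_state"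
proof
  assume "after_tricks i deal = after_tricks j cycle_state"
  \<comment> \<open>Playing \<open>3 - i\<close> more tricks from both sides carries a supposed
    coincidence to the state after three tricks; \<open>i < 4\<close> makes the truncated
    subtraction exact.\<close>
  then have "after_tricks (3 - i + i) deal = after_tricks (3 - i + j) cycle_state"
    by (simp only: after_tricks_add)
  then have "after_tricks 3 deal = after_tricks ((3 - i + j) mod 62) cycle_state"
    using assms by (simp add: after_tricks_mod_period[OF cycle_returns])
  then show False
    using deal_last_before_cycle after_tricks_in_iterates[of "(3 - i + j) mod 62" 62 cycle_state]
    by (auto simp: list_all_iff)
qed

theorem mainTheorem1:
  "(\<exists>h1 h2. equal_deal h1 h2 \<and> non_terminating (State h1 h2 P1)) \<and>
   (let h1 = hand ''---K---Q-KQAJ-----AAJ--J--'';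
        h2 = hand ''----------Q----KQ-J-----KA'';
        s = State h1 h2 P1;
        c = State (hand ''---AAJ--J--------K---------Q-Q-K---Q-KAQJ-'')
                  (hand ''-----KA-J-'') P2
    in equal_deal h1 h2 \<and>
       non_terminating s \<and>
       after_tricks 4 s = c \<and>
       after_tricks 62 c = c \<and>
       (\<forall>k. 0 < k \<and> k < 62 \<longrightarrow> after_tricks k c \<noteq> c) \<and>
       (\<forall>m. after_tricks (4 + 62 * m) s = c) \<and>
       (\<forall>i < 4. \<forall>j. after_tricks i s \<noteq> after_tricks j c))"
proof -
  have nt: "non_terminating deal"
    by (rule non_terminatingI[OF deal_to_cycle cycle_returns _ deal_not_over cycle_not_over]) simp
  have "after_tricks (4 + 62 * m) deal = cycle_state" for m
    using after_tricks_add[of "62 * m" 4 deal]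
    by (simp add: add.commute deal_to_cycle after_tricks_period_mult[OF cycle_returns])
  then show ?thesis
    using equal_deal_start nt deal_to_cycle cycle_returns cycle_minimal before_cycle
    unfolding Let_def deal_def cycle_state_def by blast
qed

end
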